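(* For any $p,q\in\mathbb{Q}$ such that $1<p<q<\infty$, $r_{p,q}(\mathbb{Z}_3)$ is an algebraic number.
   Context: Let $\mathbb{Z}_3=\mathbb{Z}/3\mathbb{Z}$ be equipped with the uniform probability measure, and let $L^p(\mathbb{Z}_3)$ be the space of complex-valued functions on $\mathbb{Z}_3$ with $\|f\|_p=\big(\frac13\sum_{k\in\mathbb{Z}_3}|f(k)|^p\big)^{1/p}$. Let $\chi$ be the character of $\mathbb{Z}_3$ with $\chi(1)=e^{2\pi i/3}$, so that every function is uniquely $f=a_0+a_1\chi+a_2\overline{\chi}$ with $a_0,a_1,a_2\in\mathbb{C}$. For $r\in[0,1]$ define $T_r(a_0+a_1\chi+a_2\overline{\chi})=a_0+ra_1\chi+ra_2\overline{\chi}$. For $1<p<q<\infty$, $r_{p,q}(\mathbb{Z}_3)\in[0,1]$ is the largest constant such that $\|T_rf\|_q\le\|f\|_p$ for all $0\le r\le r_{p,q}(\mathbb{Z}_3)$ and all $f\in L^p(\mathbb{Z}_3)$. *)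

theory Defs
  imports "HOL-Analysis.Analysis" "HOL-Computational_Algebra.Polynomial"
begin

text \<open>
  The group Z/3Z is the numeral type \<open>3\<close>, whose addition is addition modulo 3
  (in particular \<open>(3::3) = 0\<close>).
\<close>

definition Z3_norm :: "real \<Rightarrow> (3 \<Rightarrow> complex) \<Rightarrow> real" where
  "Z3_norm p f = ((1/3) * (\<Sum>k\<in>UNIV. cmod (f k) powr p)) powr (1/p)"

definition Z3_char :: "3 \<Rightarrow> complex" where
  "Z3_char k = (if k = 0 then 1 else if k = 1 then exp (2 * of_real pi * \<i> / 3)
     else exp (2 * of_real pi * \<i> / 3) ^ 2)"

definition Z3_comb :: "complex \<Rightarrow> complex \<Rightarrow> complex \<Rightarrow> 3 \<Rightarrow> complex" where
  "Z3_comb a0 a1 a2 = (\<lambda>k. a0 + a1 * Z3_char k + a2 * cnj (Z3_char k))"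

text \<open>
  \<open>Z3_comb_exists\<close> and \<open>Z3_comb_inject\<close> below show that the witness
  \<open>(a0, a1, a2)\<close> in \<open>Z3_T\<close> exists and is unique.
\<close>

definition Z3_T :: "real \<Rightarrow> (3 \<Rightarrow> complex) \<Rightarrow> 3 \<Rightarrow> complex" where
  "Z3_T r f = (THE g. \<exists>a0 a1 a2. f = Z3_comb a0 a1 a2 \<and>
     g = Z3_comb a0 (of_real r * a1) (of_real r * a2))"

definition Z3_hypercontractive :: "real \<Rightarrow> real \<Rightarrow> real \<Rightarrow> bool" where
  "Z3_hypercontractive p q r \<longleftrightarrow>
     (\<forall>s f. 0 \<le> s \<and> s \<le> r \<longrightarrow> Z3_norm q (Z3_T s f) \<le> Z3_norm p f)"

text \<open>
  The greatest element exists for \<open>1 < p < q\<close>, see \<open>Z3_r_attained\<close> below.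
\<close>

definition Z3_r :: "real \<Rightarrow> real \<Rightarrow> real" where
  "Z3_r p q = (GREATEST r. 0 \<le> r \<and> r \<le> 1 \<and> Z3_hypercontractive p q r)"

lemma Z3_three: "(3::3) = 0"
  by simp

lemma Z3_root: "exp (2 * of_real pi * \<i> / 3) = Complex (-1/2) (sqrt 3 / 2)"
proof -
  have "exp (2 * of_real pi * \<i> / 3) = cis (2 * pi / 3)"
    by (simp add: cis_conv_exp mult_ac)
  also have "\<dots> = Complex (-1/2) (sqrt 3 / 2)"
    by (simp add: complex_eq_iff cos_120 sin_120)
  finally show ?thesis .
qed

lemma Z3_char_simps:
  "Z3_char 0 = 1"
  "Z3_char 1 = Complex (-1/2) (sqrt 3 / 2)"
  "Z3_char 2 = Complex (-1/2) (- sqrt 3 / 2)"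
proof -
  show "Z3_char 0 = 1" "Z3_char 1 = Complex (-1/2) (sqrt 3 / 2)"
    by (simp_all add: Z3_char_def Z3_root)
  show "Z3_char 2 = Complex (-1/2) (- sqrt 3 / 2)"
    by (simp add: Z3_char_def Z3_root complex_eq_iff power2_eq_square)
qed

lemma Z3_char_add: "Z3_char (x + y) = Z3_char x * Z3_char y"
proof -
  have x: "x = 0 \<or> x = 1 \<or> x = 2" and y: "y = 0 \<or> y = 1 \<or> y = 2"
    using exhaust_3[of x] exhaust_3[of y] Z3_three by auto
  have e: "(1::3) + 1 = 2" "(1::3) + 2 = 0" "(2::3) + 1 = 0" "(2::3) + 2 = 1"
    by simp_all
  show ?thesis using x y
    by (elim disjE; simp only: e add_0_left add_0_right Z3_char_simps;
        simp add: complex_eq_iff)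
qed

lemma Z3_fun_eq_iff: "f = g \<longleftrightarrow> f 0 = g 0 \<and> f 1 = g 1 \<and> f (2::3) = g 2"
  unfolding fun_eq_iff forall_3 Z3_three by blast

lemma Z3_comb_inject:
  assumes "Z3_comb a0 a1 a2 = Z3_comb b0 b1 b2"
  shows "a0 = b0 \<and> a1 = b1 \<and> a2 = b2"
proof -
  let ?w = "Complex (-1/2) (sqrt 3 / 2)" and ?v = "Complex (-1/2) (- sqrt 3 / 2)"
  have c: "?v = -1 - ?w" "cnj ?w = -1 - ?w" "cnj (-1 - ?w) = ?w" 
    by (simp_all add: complex_eq_iff)
  have w: "?w * ?w = -1 - ?w" by (simp add: complex_eq_iff)
  define w where "w = ?w"
  have ww: "w * w = -1 - w" using w unfolding w_def .
  have e: "a0 + a1 + a2 = b0 + b1 + b2"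
    "a0 + a1 * w + a2 * (-1 - w) = b0 + b1 * w + b2 * (-1 - w)"
    "a0 + a1 * (-1 - w) + a2 * w = b0 + b1 * (-1 - w) + b2 * w"
    using assms unfolding Z3_fun_eq_iff[of "Z3_comb a0 a1 a2"] unfolding Z3_comb_def Z3_char_simps c w_def
    by (simp_all)
  have "3 * a0 = 3 * b0" "3 * a1 = 3 * b1" using e ww by algebra+
  then show ?thesis using e(1) by simp
qed

lemma Z3_comb_exists: "\<exists>a0 a1 a2. f = Z3_comb a0 a1 a2"
proof -
  let ?w = "Complex (-1/2) (sqrt 3 / 2)" and ?v = "Complex (-1/2) (- sqrt 3 / 2)"
  have c: "?v = -1 - ?w" "cnj ?w = -1 - ?w" "cnj (-1 - ?w) = ?w" 
    by (simp_all add: complex_eq_iff)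
  have w: "?w * ?w = -1 - ?w" by (simp add: complex_eq_iff)
  define w where "w = ?w"
  have ww: "w * w = -1 - w" using w unfolding w_def .
  define a0 a1 a2 where "a0 = (f 0 + f 1 + f 2) / 3"
    and "a1 = (f 0 + f 1 * (-1 - w) + f 2 * w) / 3"
    and "a2 = (f 0 + f 1 * w + f 2 * (-1 - w)) / 3"
  have a: "3 * a0 = f 0 + f 1 + f 2" "3 * a1 = f 0 + f 1 * (-1 - w) + f 2 * w"
    "3 * a2 = f 0 + f 1 * w + f 2 * (-1 - w)"
    by (simp_all add: a0_def a1_def a2_def)
  have "3 * f 0 = 3 * (a0 + a1 + a2)"
    "3 * f 1 = 3 * (a0 + a1 * w + a2 * (-1 - w))"
    "3 * f 2 = 3 * (a0 + a1 * (-1 - w) + a2 * w)"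
    using a ww by algebra+
  then have "f 0 = a0 + a1 + a2" "f 1 = a0 + a1 * w + a2 * (-1 - w)"
    "f 2 = a0 + a1 * (-1 - w) + a2 * w"
    by (metis mult_left_cancel zero_neq_numeral)+
  then have "f = Z3_comb a0 a1 a2"
    unfolding Z3_fun_eq_iff[of f] unfolding Z3_comb_def Z3_char_simps c w_def by simp
  then show ?thesis by blast
qed

lemma Z3_T_comb:
  "Z3_T r (Z3_comb a0 a1 a2) = Z3_comb a0 (of_real r * a1) (of_real r * a2)"
  unfolding Z3_T_def by (rule the_equality) (use Z3_comb_inject in blast)+

lemma Z3_norm_const:
  assumes "p > 0" shows "Z3_norm p (\<lambda>_. a) = cmod a"
  using assms by (simp add: Z3_norm_def sum_3 powr_powr)

lemma Z3_hypercontractive_0: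
  assumes "1 < p" "p < q"
  shows "Z3_hypercontractive p q 0"
proof -
  have "Z3_norm q (Z3_T 0 f) \<le> Z3_norm p f" for f
  proof -
    obtain a0 a1 a2 where f: "f = Z3_comb a0 a1 a2" using Z3_comb_exists by blast
    have T: "Z3_T 0 f = (\<lambda>_. a0)" unfolding f Z3_T_comb by (simp add: Z3_comb_def)
    have "3 * a0 = f 0 + f 1 + f 2"
      unfolding f Z3_comb_def Z3_char_simps by (simp add: complex_eq_iff)
    then have "3 * cmod a0 = cmod (f 0 + f 1 + f 2)"
      by (metis norm_mult norm_numeral)
    also have "\<dots> \<le> cmod (f 0) + cmod (f 1) + cmod (f 2)"
      by (meson norm_triangle_ineq norm_triangle_le order.refl add_mono order_trans)
    finally have "cmod a0 \<le> (\<Sum>k\<in>UNIV. 1/3 * cmod (f k))"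
      by (simp only: sum_3 Z3_three)
    also have "\<dots> \<le> ((1/3) * (\<Sum>k\<in>UNIV. cmod (f k) powr p)) powr (1/p)" (is "?m \<le> _")
    proof (cases "?m = 0")
      case False
      define m where "m = ?m"
      have m: "m > 0" unfolding m_def using False by (simp add: sum_nonneg less_le)
      have "cmod (f k) / m * 1 \<le> (cmod (f k) / m) powr p / p + 1 powr (p/(p-1)) / (p/(p-1))" for k
        using assms m by (intro Youngs_inequality) (auto simp: field_simps)
      then have y: "cmod (f k) / m \<le> (cmod (f k) powr p / m powr p) / p + (1 - 1/p)" for k
        using assms m by (simp add: powr_divide diff_divide_distrib)
      have "(\<Sum>k\<in>UNIV. cmod (f k) / m)
          \<le> (\<Sum>k\<in>UNIV. (cmod (f k) powr p / m powr p) / p + (1 - 1/p))"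
        by (intro sum_mono y)
      also have "(\<Sum>k\<in>UNIV. cmod (f k) / m) = 3"
        using m by (simp add: m_def field_simps sum_3 flip: sum_divide_distrib)
      finally have "3 / p \<le> (\<Sum>k\<in>UNIV. cmod (f k) powr p) / m powr p / p"
        by (simp add: sum.distrib flip: sum_divide_distrib)
      then have "3 \<le> (\<Sum>k\<in>UNIV. cmod (f k) powr p) / m powr p"
        using assms by (simp only: divide_le_cancel)
      then have "m powr p \<le> (1/3) * (\<Sum>k\<in>UNIV. cmod (f k) powr p)"
        using m by (simp add: field_simps)
      then have "(m powr p) powr (1/p) \<le> ((1/3) * (\<Sum>k\<in>UNIV. cmod (f k) powr p)) powr (1/p)"
        using assms by (intro powr_mono2) auto
      then show ?thesis using assms m by (simp add: powr_powr m_def)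
    qed simp
    finally show ?thesis using assms by (simp add: T Z3_norm_const) (simp add: Z3_norm_def)
  qed
  then show ?thesis by (auto simp: Z3_hypercontractive_def)
qed

lemma Z3_r_attained:
  assumes "1 < p" "p < q"
  shows "0 \<le> Z3_r p q" "Z3_r p q \<le> 1" "Z3_hypercontractive p q (Z3_r p q)"
    and "\<And>r. 0 \<le> r \<Longrightarrow> r \<le> 1 \<Longrightarrow> Z3_hypercontractive p q r \<Longrightarrow> r \<le> Z3_r p q"
proof -
  define P where "P r \<longleftrightarrow> 0 \<le> r \<and> r \<le> 1 \<and> Z3_hypercontractive p q r" for r
  define m where "m = Sup (Collect P)"
  have P0: "P 0" using Z3_hypercontractive_0[OF assms] by (simp add: P_def)
  have bdd: "bdd_above (Collect P)" by (auto simp: P_def bdd_above_def)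
  have m: "0 \<le> m" "m \<le> 1"
    unfolding m_def using P0 bdd by (auto intro: cSup_upper cSup_least simp: P_def)
  have cl: "m \<in> closure (Collect P)"
    unfolding m_def using P0 bdd by (intro closure_contains_Sup) auto
  have bound: "Z3_norm q (Z3_T s f) \<le> Z3_norm p f" if "0 \<le> s" "s \<le> m" for s f
  proof (cases "s < m")
    case True
    then obtain r where "P r" "s < r"
      unfolding m_def using P0 bdd by (subst (asm) less_cSup_iff) auto
    then show ?thesis using that by (auto simp: P_def Z3_hypercontractive_def)
  next
    case False
    obtain a0 a1 a2 where f: "f = Z3_comb a0 a1 a2" using Z3_comb_exists by blast
    let ?C = "{s. Z3_norm q (Z3_T s f) \<le> Z3_norm p f}"
    have "continuous_on UNIV (\<lambda>s. Z3_norm q (Z3_T s f))"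
      unfolding f Z3_T_comb unfolding Z3_comb_def Z3_norm_def
      using assms by (intro continuous_intros continuous_on_powr' ballI conjI impI) (auto intro!: sum_nonneg)
    then have "closed ?C" by (intro closed_Collect_le continuous_intros)
    moreover have "Collect P \<subseteq> ?C" by (auto simp: P_def Z3_hypercontractive_def)
    ultimately have "closure (Collect P) \<subseteq> ?C" by (rule closure_minimal[rotated])
    then show ?thesis using cl False that by force
  qed
  have Pm: "P m" using m bound by (simp add: P_def Z3_hypercontractive_def)
  have up: "r \<le> m" if "P r" for r
    unfolding m_def using that bdd by (auto intro: cSup_upper)
  have "Z3_r p q = m"
    unfolding Z3_r_def using Pm up by (intro Greatest_equality) (auto simp: P_def)
  then show "0 \<le> Z3_r p q" "Z3_r p q \<le> 1" "Z3_hypercontractive p q (Z3_r p q)"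
    "\<And>r. 0 \<le> r \<Longrightarrow> r \<le> 1 \<Longrightarrow> Z3_hypercontractive p q r \<Longrightarrow> r \<le> Z3_r p q"
    using Pm up by (auto simp: P_def)
qed

end

theory Submission
  imports Defs "HOL-Real_Asymp.Real_Asymp"
begin

text \<open>
  Suppose \<open>r = r\<^sub>p\<^sub>,\<^sub>q\<close> is transcendental. Since \<open>T\<^sub>r\<close> is a positive operator, only functions
  \<open>1 + u \<ge> 0\<close> with \<open>u\<close> of mean zero matter, and \<open>T\<^sub>r (1 + u) = 1 + r u\<close>. Violations of the
  inequality for parameters decreasing to \<open>r\<close> accumulate at some \<open>u\<close> with equality at \<open>r\<close>.
  If \<open>u = 0\<close>, the second-order expansion at the constant function gives
  \<open>r\<^sup>2 = (p - 1) / (q - 1)\<close>. If \<open>u \<noteq> 0\<close>, then \<open>u\<close> is a critical point. Instead of eliminating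
  \<open>u\<close> from the critical equations, apply a derivation \<open>D\<close> of a finitely generated subring of
  the reals with \<open>D r = 1\<close> to the equality: by criticality the terms in \<open>D u\<close> cancel and
  \<open>\<Sum>\<^sub>k (1 + r u\<^sub>k) powr (q - 1) * u\<^sub>k = 0\<close> remains, which forces \<open>u = 0\<close>.
\<close>

section \<open>Derivations\<close>

text \<open>\<open>A\<close> is a subring, but \<open>D\<close> takes values anywhere in the ambient
  ring: it is a derivation of \<open>A\<close> into that ring as an \<open>A\<close>-module. The
  quotients that \<open>derivation_on_extend\<close> prescribes as new values may thus lie outside
  the subring.\<close>

definition derivation_on :: "'a::comm_ring_1 set \<Rightarrow> ('a \<Rightarrow> 'a) \<Rightarrow> bool" where
  "derivation_on A D \<longleftrightarrow> 1 \<in> A \<and>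
     (\<forall>x\<in>A. \<forall>y\<in>A. x - y \<in> A \<and> x * y \<in> A \<and>
        D (x - y) = D x - D y \<and> D (x * y) = D x * y + x * D y)"

definition polys_over :: "'a::zero set \<Rightarrow> 'a poly set" where
  "polys_over A = {p. \<forall>i. coeff p i \<in> A}"

text \<open>The value at \<open>p(t)\<close> of the extension of \<open>D\<close> to \<open>A[t]\<close> that maps \<open>t\<close> to \<open>c\<close>.\<close>

definition adjoin_value :: "('a \<Rightarrow> 'a) \<Rightarrow> 'a \<Rightarrow> 'a \<Rightarrow> 'a::idom poly \<Rightarrow> 'a" where
  "adjoin_value D t c p = poly (map_poly D p) t + poly (pderiv p) t * c"

context
  fixes A :: "'a::idom set" and D :: "'a \<Rightarrow> 'a"
  assumes der: "derivation_on A D"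
begin

lemma derivation_on_mem:
  shows "1 \<in> A" "0 \<in> A"
    and "x \<in> A \<Longrightarrow> y \<in> A \<Longrightarrow> x - y \<in> A"
    and "x \<in> A \<Longrightarrow> - x \<in> A"
    and "x \<in> A \<Longrightarrow> y \<in> A \<Longrightarrow> x + y \<in> A"
    and "x \<in> A \<Longrightarrow> y \<in> A \<Longrightarrow> x * y \<in> A"
proof -
  show one: "1 \<in> A" using der by (simp add: derivation_on_def)
  show diff: "x - y \<in> A" if "x \<in> A" "y \<in> A" for x y
    using der that by (simp add: derivation_on_def)
  show zero: "0 \<in> A" using diff[OF one one] by simp
  show minus: "- x \<in> A" if "x \<in> A" for x using diff[OF zero that] by simp
  show "x + y \<in> A" if "x \<in> A" "y \<in> A" for x y using diff[OF that(1) minus[OF that(2)]] by simp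
  show "x * y \<in> A" if "x \<in> A" "y \<in> A" for x y
    using der that by (auto simp: derivation_on_def)
qed

lemma derivation_on_simps:
  shows "D 0 = 0" "D 1 = 0"
    and "x \<in> A \<Longrightarrow> y \<in> A \<Longrightarrow> D (x - y) = D x - D y"
    and "x \<in> A \<Longrightarrow> y \<in> A \<Longrightarrow> D (x + y) = D x + D y"
    and "x \<in> A \<Longrightarrow> y \<in> A \<Longrightarrow> D (x * y) = D x * y + x * D y"
proof -
  note mem = derivation_on_mem
  show diff: "D (x - y) = D x - D y" and mult: "D (x * y) = D x * y + x * D y" 
    if "x \<in> A" "y \<in> A" for x y
    using der that by (auto simp: derivation_on_def)
  show zero: "D 0 = 0" using diff[OF mem(1) mem(1)] by simp
  have "D 1 = D 1 + D 1" using mult[OF mem(1) mem(1)] by simp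
  then show "D 1 = 0" by (metis add_cancel_right_right)
  show "D (x + y) = D x + D y" if "x \<in> A" "y \<in> A" for x y
    using diff[of x "- y"] diff[of 0 y] zero that mem(2) mem(4)[of y] by simp
qed

lemma derivation_on_sum:
  assumes "\<And>i. i \<in> I \<Longrightarrow> f i \<in> A"
  shows "sum f I \<in> A" "D (sum f I) = (\<Sum>i\<in>I. D (f i))"
proof -
  have "sum f I \<in> A \<and> D (sum f I) = (\<Sum>i\<in>I. D (f i))"
    using assms
    by (induction I rule: infinite_finite_induct)
      (simp_all add: derivation_on_mem derivation_on_simps)
  then show "sum f I \<in> A" "D (sum f I) = (\<Sum>i\<in>I. D (f i))" by auto
qed

lemma derivation_on_power:
  assumes "x \<in> A"
  shows "x ^ n \<in> A" "D (x ^ Suc n) = of_nat (Suc n) * x ^ n * D x"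
proof -
  show mem: "x ^ n \<in> A" for n
    using assms by (induction n) (simp_all add: derivation_on_mem)
  show "D (x ^ Suc n) = of_nat (Suc n) * x ^ n * D x"
  proof (induction n)
    case (Suc n)
    have "D (x ^ Suc (Suc n)) = D x * x ^ Suc n + x * D (x ^ Suc n)"
      using derivation_on_simps(5)[OF assms mem[of "Suc n"]] by simp
    then show ?case unfolding Suc.IH by (simp add: algebra_simps)
  qed simp
qed

section \<open>Adjoining one element to the domain of a derivation\<close>

lemma polys_over_closed:
  assumes "p \<in> polys_over A" "q \<in> polys_over A"
  shows "p - q \<in> polys_over A" "p * q \<in> polys_over A"
  using assms by (auto simp: polys_over_def coeff_mult derivation_on_mem intro!: derivation_on_sum)

lemma monom_in_polys_over: "a \<in> A \<Longrightarrow> monom a n \<in> polys_over A"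
  by (auto simp: polys_over_def derivation_on_mem)

lemma map_poly_derivation:
  assumes "p \<in> polys_over A" "q \<in> polys_over A"
  shows "map_poly D (p - q) = map_poly D p - map_poly D q"
    and "map_poly D (p * q) = map_poly D p * q + p * map_poly D q"
  using assms
  by (auto simp: poly_eq_iff polys_over_def coeff_map_poly derivation_on_simps coeff_mult
      derivation_on_sum derivation_on_mem sum.distrib)

text \<open>Applying \<open>D\<close> to the coefficients and differentiating formally both satisfy
  the product rule, and evaluation at \<open>t\<close> preserves it.\<close>

lemma adjoin_value_simps:
  assumes "p \<in> polys_over A" "q \<in> polys_over A"
  shows "adjoin_value D t c (p - q) = adjoin_value D t c p - adjoin_value D t c q"
    and "adjoin_value D t c (p * q) = adjoin_value D t c p * poly q t + poly p t * adjoin_value D t c q"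
  unfolding adjoin_value_def map_poly_derivation[OF assms]
  by (simp_all add: pderiv_diff pderiv_mult algebra_simps)

text \<open>The assumption makes the value independent of the representing polynomial: two
  polynomials with the same value at \<open>t\<close> differ by one that vanishes there. Hence the
  choice by \<open>SOME\<close> in \<open>D'\<close> is harmless.\<close>

lemma derivation_on_adjoin:
  assumes "\<And>p. p \<in> polys_over A \<Longrightarrow> poly p t = 0 \<Longrightarrow> adjoin_value D t c p = 0"
  obtains A' D' where "derivation_on A' D'" "A \<subseteq> A'" "\<And>x. x \<in> A \<Longrightarrow> D' x = D x"
    "t \<in> A'" "D' t = c"
proof -
  define A' where "A' = (\<lambda>p. poly p t) ` polys_over A"
  define D' where "D' x = adjoin_value D t c (SOME p. p \<in> polys_over A \<and> poly p t = x)" for x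
  have D': "D' (poly p t) = adjoin_value D t c p" if "p \<in> polys_over A" for p
  proof -
    define q where "q = (SOME q. q \<in> polys_over A \<and> poly q t = poly p t)"
    have q: "q \<in> polys_over A" "poly q t = poly p t"
      unfolding q_def using someI_ex[of "\<lambda>q. q \<in> polys_over A \<and> poly q t = poly p t"] that by auto
    have "adjoin_value D t c (q - p) = 0"
      using q that by (intro assms) (simp_all add: polys_over_closed)
    then show ?thesis using q that by (simp add: D'_def q_def[symmetric] adjoin_value_simps)
  qed
  have const: "[:x:] \<in> polys_over A" if "x \<in> A" for x
    using monom_in_polys_over[OF that, of 0] by (simp add: monom_0)
  have X: "monom 1 1 \<in> polys_over A" by (intro monom_in_polys_over derivation_on_mem)
  show ?thesis
  proof (rule that)
    have "1 \<in> A'" using const[OF derivation_on_mem(1)] by (force simp: A'_def)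
    moreover have "x - y \<in> A' \<and> x * y \<in> A' \<and> D' (x - y) = D' x - D' y \<and> 
        D' (x * y) = D' x * y + x * D' y" if "x \<in> A'" "y \<in> A'" for x y
    proof -
      obtain p q where p: "p \<in> polys_over A" "x = poly p t" and q: "q \<in> polys_over A" "y = poly q t"
        using \<open>x \<in> A'\<close> \<open>y \<in> A'\<close> by (auto simp: A'_def)
      have xy: "x - y = poly (p - q) t" "x * y = poly (p * q) t" by (simp_all add: p q)
      show ?thesis unfolding xy using p q 
        by (simp add: D' polys_over_closed adjoin_value_simps A'_def del: poly_diff poly_mult)
    qed
    ultimately show "derivation_on A' D'" by (auto simp: derivation_on_def)
    show "A \<subseteq> A'" using const by (force simp: A'_def)
    show "D' x = D x" if "x \<in> A" for x 
      using D'[OF const[OF that]]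
      by (simp add: adjoin_value_def map_poly_pCons derivation_on_simps)
    show "t \<in> A'" using X by (force simp: A'_def poly_monom)
    show "D' t = c"
      using D'[OF X]
      by (simp add: poly_monom adjoin_value_def map_poly_monom derivation_on_simps pderiv_monom)
  qed
qed

end

text \<open>If no nonzero polynomial over \<open>A\<close> vanishes at \<open>t\<close>, any value
  at \<open>t\<close> is consistent. Otherwise an annihilating polynomial \<open>m\<close> of least
  degree determines the value, and pseudo-division by \<open>m\<close> shows that all other
  annihilating polynomials agree with it.\<close>

lemma derivation_on_extend:
  fixes A :: "'a::field_char_0 set"
  assumes der: "derivation_on A D"
  obtains A' D' where "derivation_on A' D'" "A \<subseteq> A'" "\<And>x. x \<in> A \<Longrightarrow> D' x = D x" "t \<in> A'"
proof -
  note closed = polys_over_closed[OF der] and simps = adjoin_value_simps[OF der]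
  define Z where "Z p \<longleftrightarrow> p \<in> polys_over A \<and> p \<noteq> 0 \<and> poly p t = 0" for p
  have "\<exists>c. \<forall>p. p \<in> polys_over A \<longrightarrow> poly p t = 0 \<longrightarrow> adjoin_value D t c p = 0"
  proof (cases "\<exists>m. Z m")
    case False
    then have "p = 0" if "p \<in> polys_over A" "poly p t = 0" for p using that by (auto simp: Z_def)
    moreover have "adjoin_value D t 0 0 = 0" by (simp add: adjoin_value_def)
    ultimately show ?thesis by blast
  next
    case True
    then obtain m where m: "Z m" and least: "\<And>p. Z p \<Longrightarrow> degree m \<le> degree p"
      using ex_has_least_nat[of Z _ degree] by blast
    have mA: "m \<in> polys_over A" and m0: "m \<noteq> 0" and mt: "poly m t = 0" using m by (auto simp: Z_def)
    have lc: "lead_coeff m \<in> A" using mA by (simp add: polys_over_def)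
    have deg: "degree m > 0"
      using m0 mt by (auto intro!: gr0I elim!: degree_eq_zeroE)
    have "of_nat n * x \<in> A" if "x \<in> A" for n x
      using that by (induction n) (simp_all add: derivation_on_mem[OF der] algebra_simps)
    then have "pderiv m \<in> polys_over A"
      using mA by (auto simp: polys_over_def coeff_pderiv simp del: of_nat_Suc)
    moreover have "pderiv m \<noteq> 0" using deg by (simp add: pderiv_eq_0_iff)
    moreover have "degree (pderiv m) < degree m" using deg by (simp add: degree_pderiv)
    \<comment> \<open>In characteristic zero the derivative of \<open>m\<close> is nonzero and of
      smaller degree, so by minimality it cannot vanish at \<open>t\<close>.\<close>
    ultimately have m't: "poly (pderiv m) t \<noteq> 0"
      using least[of "pderiv m"] by (auto simp: Z_def)
    \<comment> \<open>The solution of \<open>adjoin_value D t c m = 0\<close>.\<close>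
    define c where "c = - poly (map_poly D m) t / poly (pderiv m) t"
    have cm: "adjoin_value D t c m = 0" using m't by (simp add: adjoin_value_def c_def)
    have "adjoin_value D t c p = 0" if "p \<in> polys_over A" "poly p t = 0" for p
      using that
    proof (induction "degree p" arbitrary: p rule: less_induct)
      case less
      show ?case
      proof (cases "p = 0")
        case True
        then show ?thesis by (simp add: adjoin_value_def)
      next
        case False
        then have le: "degree m \<le> degree p" using least[of p] less.prems by (simp add: Z_def)
        define s where "s = monom (lead_coeff p) (degree p - degree m)"
        \<comment> \<open>One step of pseudo-division: \<open>A\<close> is only a ring, so
          \<open>p\<close> is multiplied by the leading coefficient of \<open>m\<close> before the
          top terms are cancelled.\<close>
        define p1 where "p1 = monom (lead_coeff m) 0 * p - s * m"
        have s: "s \<in> polys_over A" and l: "monom (lead_coeff m) 0 \<in> polys_over A"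
          using less.prems lc unfolding s_def
          by (auto simp: polys_over_def derivation_on_mem[OF der])
        have p1: "p1 \<in> polys_over A" "poly p1 t = 0"
          using less.prems s l mA mt by (simp_all add: p1_def closed)
        have "adjoin_value D t c p1 = 0"
        proof (cases "p1 = 0")
          case True
          then show ?thesis by (simp add: adjoin_value_def)
        next
          case False
          have "degree m \<le> degree p1" using least[of p1] p1 False by (simp add: Z_def)
          have "degree p1 \<le> degree p"
            unfolding p1_def
          proof (intro degree_diff_le)
            show "degree (monom (lead_coeff m) 0 * p) \<le> degree p"
              by (simp add: monom_0 )
            show "degree (s * m) \<le> degree p"
              using degree_mult_le[of s m] degree_monom_le[of "lead_coeff p" "degree p - degree m"] le
              unfolding s_def by linarith
          qed
          moreover have "coeff p1 (degree p) = 0"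
            using le by (simp add: p1_def s_def coeff_monom_mult monom_0)
          ultimately have "degree p1 < degree p"
            using False by (metis le_neq_implies_less leading_coeff_0_iff)
          then show ?thesis using p1 less.hyps by blast
        qed
        \<comment> \<open>In the product rule for \<open>p1\<close>, every other term contains
          \<open>poly p t\<close>, \<open>poly m t\<close> or \<open>adjoin_value D t c m\<close>,
          all of which are zero.\<close>
        then have "lead_coeff m * adjoin_value D t c p = 0"
          using less.prems s l mA mt cm by (simp add: p1_def simps closed poly_monom)
        then show ?thesis using m0 by simp
      qed
    qed
    then show ?thesis by blast
  qed
  then obtain c where "\<And>p. p \<in> polys_over A \<Longrightarrow> poly p t = 0 \<Longrightarrow> adjoin_value D t c p = 0" by blast
  then show ?thesis using derivation_on_adjoin[OF der] that by metis
qed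

text \<open>The zero derivation on the integers extends to \<open>r\<close> with value 1, because no
  nonzero integer polynomial vanishes at \<open>r\<close>. The elements of \<open>S\<close> are then
  adjoined one at a time, without changing earlier values.\<close>

lemma transcendental_derivation:
  fixes r :: "'a::field_char_0"
  assumes "\<not> algebraic r" "finite S"
  obtains A D where "derivation_on A D" "r \<in> A" "D r = 1" "S \<subseteq> A"
proof -
  have "\<exists>A D. derivation_on A D \<and> r \<in> A \<and> D r = 1 \<and> S \<subseteq> A"
    using assms(2)
  proof (induction S rule: finite_induct)
    case empty
    have Z: "derivation_on \<int> (\<lambda>_::'a. 0)" by (auto simp: derivation_on_def)
    have "p = 0" if "p \<in> polys_over \<int>" "poly p r = 0" for p
      using that assms(1) by (auto simp: algebraic_def polys_over_def)
    moreover have "adjoin_value (\<lambda>_. 0) r 1 0 = 0" by (simp add: adjoin_value_def)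
    ultimately have "adjoin_value (\<lambda>_. 0) r 1 p = 0" if "p \<in> polys_over \<int>" "poly p r = 0" for p
      using that by metis
    then show ?case using derivation_on_adjoin[OF Z, of r 1] by (metis empty_subsetI)
  next
    case (insert t S)
    then obtain A D where AD: "derivation_on A D" "r \<in> A" "D r = 1" "S \<subseteq> A" by blast
    then obtain A' D' where "derivation_on A' D'" "A \<subseteq> A'" "\<And>x. x \<in> A \<Longrightarrow> D' x = D x" "t \<in> A'"
      using derivation_on_extend by metis
    then show ?case using AD by (intro exI[of _ A'] exI[of _ D']) auto
  qed
  then show ?thesis using that by blast
qed

text \<open>For \<open>a = m / n\<close> the power \<open>y = x powr a\<close> satisfies
  \<open>y ^ n = x ^ m\<close>, and \<open>D\<close> is applied to this polynomial relation. This is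
  where rationality of the exponents enters.\<close>

lemma derivation_on_powr:
  fixes x a :: real
  assumes der: "derivation_on A D" and x: "x \<in> A" "x powr a \<in> A" "x > 0" and a: "a \<in> \<rat>" "a > 0"
  shows "D (x powr a) = a * x powr (a - 1) * D x"
proof -
  obtain m n :: nat where mn: "n > 0" "a = real m / real n"
    using a Rats_abs_nat_div_natE[of a] by (metis abs_of_pos neq0_conv)
  then have "m > 0" using a by (cases m) auto
  define y where "y = x powr a"
  have y: "y > 0" "y \<in> A" using x by (auto simp: y_def)
  have "y ^ n = x ^ m" using x mn by (simp add: y_def powr_realpow[symmetric] powr_powr)
  moreover obtain i j where ij: "m = Suc i" "n = Suc j" using mn \<open>m > 0\<close> by (metis Suc_pred)
  ultimately have eq: "y ^ Suc j = x ^ Suc i" by simp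
  then have "real n * y ^ j * D y = real m * x ^ i * D x"
    using derivation_on_power(2)[OF der x(1), of i] derivation_on_power(2)[OF der y(2), of j] ij
    by simp
  \<comment> \<open>The factor \<open>x * y\<close> restores the full powers \<open>y ^ n\<close>
    and \<open>x ^ m\<close>, which are equal and can be cancelled.\<close>
  then have "(x * y) * (real n * y ^ j * D y) = (x * y) * (real m * x ^ i * D x)" by simp
  then have "y ^ Suc j * (real n * x * D y) = x ^ Suc i * (real m * y * D x)"
    by (simp add: algebra_simps)
  moreover have "x ^ Suc i > 0" using x by simp
  ultimately have "real n * x * D y = real m * y * D x"
    unfolding eq by (metis mult_left_cancel less_irrefl)
  then have "real n * (x * D y) = real n * (a * y * D x)" using mn by simp
  then have "x * D y = a * y * D x" using mn(1) by (simp only: mult_left_cancel of_nat_eq_0_iff)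
  then show ?thesis using x by (simp add: y_def powr_diff field_simps)
qed

section \<open>Reduction to nonnegative functions of mean one\<close>

text \<open>The two nontrivial characters sum to zero, so \<open>a0\<close> is the mean. For
  \<open>r\<close> between 0 and 1 this is a convex combination of the mean and the identity, which
  makes the operator positive.\<close>

lemma Z3_T_eq: "Z3_T r f k = (1 - of_real r) * ((\<Sum>j\<in>UNIV. f j) / 3) + of_real r * f k"
proof -
  obtain a0 a1 a2 where f: "f = Z3_comb a0 a1 a2" using Z3_comb_exists by blast
  have "(\<Sum>j\<in>UNIV. f j) = 3 * a0"
    unfolding sum_3 Z3_three f Z3_comb_def Z3_char_simps by (simp add: complex_eq_iff)
  then show ?thesis
    unfolding f Z3_T_comb by (simp add: Z3_comb_def algebra_simps)
qed

text \<open>For centered \<open>u\<close> and \<open>r\<close> in \<open>[0,1]\<close> this is the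
  \<open>q\<close>-th power of the \<open>p\<close>-norm of \<open>1 + u\<close> minus the
  \<open>q\<close>-th power of the \<open>q\<close>-norm of \<open>1 + r u\<close>.\<close>

definition Z3_gap :: "real \<Rightarrow> real \<Rightarrow> real \<Rightarrow> (3 \<Rightarrow> real) \<Rightarrow> real" where
  "Z3_gap p q r u =
     ((\<Sum>k\<in>UNIV. (1 + u k) powr p) / 3) powr (q / p) - (\<Sum>k\<in>UNIV. (1 + r * u k) powr q) / 3"

text \<open>Equivalently, \<open>1 + u\<close> is nonnegative of mean one. Zeros of
  \<open>1 + u\<close> are allowed, which keeps the set closed.\<close>

definition Z3_centered :: "(3 \<Rightarrow> real) \<Rightarrow> bool" where
  "Z3_centered u \<longleftrightarrow> (\<Sum>k\<in>UNIV. u k) = 0 \<and> (\<forall>k. -1 \<le> u k)"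

lemma Z3_centered_scale: "Z3_centered u \<Longrightarrow> 0 \<le> r \<Longrightarrow> r \<le> 1 \<Longrightarrow> 0 \<le> 1 + r * u k"
  using mult_left_mono[of "-1" "u k" r] by (force simp: Z3_centered_def)

lemma powr_inverse_le_iff:
  fixes x y p q :: real
  assumes "0 < p" "0 < q" "0 \<le> x" "0 \<le> y"
  shows "y powr (1 / q) \<le> x powr (1 / p) \<longleftrightarrow> y \<le> x powr (q / p)"
proof -
  have "y powr (1 / q) \<le> x powr (1 / p) \<longleftrightarrow> (y powr (1 / q)) powr q \<le> (x powr (1 / p)) powr q"
    using assms by (metis powr_ge_zero powr_less_mono2 powr_mono2 less_imp_le not_le)
  then show ?thesis using assms by (simp add: powr_powr)
qed

lemma Z3_norm_gap:
  assumes "0 < p" "0 < q" "Z3_centered u" "0 \<le> r" "r \<le> 1" and M: "0 < M"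
  shows "Z3_norm q (\<lambda>k. of_real (M * (1 + r * u k))) \<le> Z3_norm p (\<lambda>k. of_real (M * (1 + u k)))
    \<longleftrightarrow> 0 \<le> Z3_gap p q r u"
proof -
  have norm: "Z3_norm a (\<lambda>k. of_real (M * (1 + b * u k)))
      = M * ((\<Sum>k\<in>UNIV. (1 + b * u k) powr a) / 3) powr (1 / a)"
    if "0 < a" "0 \<le> b" "b \<le> 1" for a b
  proof -
    have norm_term: "(cmod (of_real (M * (1 + b * u k)))) powr a = M powr a * (1 + b * u k) powr a" for k
      using Z3_centered_scale[OF assms(3), of b k] that M
      by (simp only: norm_of_real) (simp add: powr_mult)
    then have "Z3_norm a (\<lambda>k. of_real (M * (1 + b * u k)))
        = (M powr a * ((\<Sum>k\<in>UNIV. (1 + b * u k) powr a) / 3)) powr (1 / a)"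
      unfolding Z3_norm_def norm_term sum_distrib_left[symmetric] by simp
    also have "\<dots> = (M powr a) powr (1 / a) * ((\<Sum>k\<in>UNIV. (1 + b * u k) powr a) / 3) powr (1 / a)"
      by (rule powr_mult)
    finally show ?thesis using that M by (simp add: powr_powr)
  qed
  show ?thesis
    using norm[of p 1] norm[of q r] assms 
    by (simp add: powr_inverse_le_iff Z3_gap_def sum_nonneg)
qed

lemma Z3_gap_nonneg:
  assumes "0 < p" "0 < q" "0 \<le> r" "r \<le> 1" and hyp: "Z3_hypercontractive p q r" and u: "Z3_centered u"
  shows "0 \<le> Z3_gap p q r u"
proof -
  have "(\<Sum>k\<in>UNIV. complex_of_real (1 + u k)) = 3"
    using u by (simp add: sum.distrib Z3_centered_def flip: of_real_sum)
  then have "Z3_T r (\<lambda>k. of_real (1 + u k)) = (\<lambda>k. of_real (1 + r * u k))"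
    by (auto simp: Z3_T_eq algebra_simps)
  then have "Z3_norm q (\<lambda>k. of_real (1 + r * u k)) \<le> Z3_norm p (\<lambda>k. of_real (1 + u k))"
    using hyp assms(3) unfolding Z3_hypercontractive_def by (metis order_refl)
  then show ?thesis using Z3_norm_gap[of p q u r 1] assms by simp
qed

text \<open>By positivity, replacing \<open>f\<close> by its modulus keeps the \<open>p\<close>-norm
  and can only increase the \<open>q\<close>-norm of the image. Dividing by the mean
  \<open>M\<close> of the modulus gives \<open>1 + u\<close>.\<close>

lemma Z3_gap_neg:
  assumes "0 < p" "0 < q" "s \<le> 1" and hyp: "\<not> Z3_hypercontractive p q s"
  obtains r u where "0 \<le> r" "r \<le> s" "Z3_centered u" "Z3_gap p q r u < 0"
proof -
  obtain r f where r: "0 \<le> r" "r \<le> s" and less: "Z3_norm p f < Z3_norm q (Z3_T r f)"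
    using hyp by (auto simp: Z3_hypercontractive_def not_le)
  have r1: "r \<le> 1" using r assms by simp
  define M where "M = (\<Sum>k\<in>UNIV. cmod (f k)) / 3"
  have "M \<noteq> 0"
  proof
    assume "M = 0"
    then have "f = (\<lambda>_. 0)" by (auto simp: M_def sum_nonneg_eq_0_iff)
    moreover from this have "Z3_T r f = (\<lambda>_. 0)" by (auto simp: Z3_T_eq)
    ultimately show False using less by (simp add: Z3_norm_def)
  qed
  then have M: "M > 0" by (simp add: M_def sum_nonneg less_le)
  define u where "u k = cmod (f k) / M - 1" for k
  have fu: "cmod (f k) = M * (1 + u k)" for k using M by (simp add: u_def)
  have u: "Z3_centered u"
    using M by (auto simp: Z3_centered_def u_def sum_subtractf simp flip: sum_divide_distrib)
      (simp add: M_def)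
  have Tu: "cmod (Z3_T r f k) \<le> M * (1 + r * u k)" for k
  proof -
    have "cmod (Z3_T r f k) \<le> cmod ((1 - of_real r) * ((\<Sum>j\<in>UNIV. f j) / 3)) + cmod (of_real r * f k)"
      unfolding Z3_T_eq by (rule norm_triangle_ineq)
    also have "cmod ((1 - of_real r) * ((\<Sum>j\<in>UNIV. f j) / 3)) = (1 - r) * (cmod (\<Sum>j\<in>UNIV. f j) / 3)"
    proof -
      have "cmod (1 - of_real r) = cmod (of_real (1 - r))" by simp
      also have "\<dots> = 1 - r" using r1 by (simp only: norm_of_real)
      finally show ?thesis by (simp add: norm_mult norm_divide)
    qed
    also have "\<dots> \<le> (1 - r) * M"
      using r1 by (auto intro!: mult_left_mono simp: M_def norm_sum)
    also have "cmod (of_real r * f k) = r * (M * (1 + u k))" using r by (simp add: norm_mult fu)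
    finally show ?thesis by (simp add: algebra_simps)
  qed
  have "Z3_norm p (\<lambda>k. of_real (M * (1 + u k))) = Z3_norm p f"
    by (simp add: Z3_norm_def flip: fu)
  also note less
  also have "Z3_norm q (Z3_T r f) \<le> Z3_norm q (\<lambda>k. of_real (M * (1 + r * u k)))"
    unfolding Z3_norm_def
    using assms Tu order_trans[OF norm_ge_zero Tu]
    by (auto intro!: powr_mono2 mult_left_mono sum_mono sum_nonneg simp del: of_real_mult of_real_add)
  finally have "Z3_gap p q r u < 0" using Z3_norm_gap[of p q u r M] assms u r r1 M by simp
  then show ?thesis using that r u by blast
qed

section \<open>Nonconstant extremizers\<close>

text \<open>Since \<open>u\<close> sums to zero, 1 may be subtracted from each weight. As
  \<open>q - 1 > 0\<close>, the new weight has the sign of \<open>u k\<close>, so every term with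
  \<open>u k\<close> nonzero is positive.\<close>

lemma centered_weighted_power_sum_eq_0:
  fixes u :: "'a::finite \<Rightarrow> real"
  assumes "r > 0" "q > 1" "(\<Sum>k\<in>UNIV. u k) = 0" "\<And>k. 1 + r * u k > 0"
    and eq: "(\<Sum>k\<in>UNIV. (1 + r * u k) powr (q - 1) * u k) = 0"
  shows "u k = 0"
proof (rule ccontr)
  assume "u k \<noteq> 0"
  have pos: "((1 + r * u j) powr (q - 1) - 1) * u j > 0" if "u j \<noteq> 0" for j
  proof (cases "u j > 0")
    case True
    then show ?thesis using assms by (simp add: gr_one_powr)
  next
    case False
    then have "u j < 0" "r * u j < 0" using that assms by (simp_all add: mult_pos_neg)
    then have "(1 + r * u j) powr (q - 1) < 1 powr (q - 1)"
      using assms(2) assms(4)[of j] by (intro powr_less_mono2) auto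
    then show ?thesis using \<open>u j < 0\<close> by (simp add: mult_neg_neg)
  qed
  have "0 < (\<Sum>j\<in>UNIV. ((1 + r * u j) powr (q - 1) - 1) * u j)"
    using pos \<open>u k \<noteq> 0\<close> by (intro sum_pos2[of _ k]) (auto intro: less_imp_le, metis less_imp_le mult_zero_right order_refl)
  also have "\<dots> = 0" using eq assms(3) by (simp add: left_diff_distrib sum_subtractf)
  finally show False by simp
qed

lemma Z3_gap_zero_transcendental:
  assumes pq: "p \<in> \<rat>" "q \<in> \<rat>" "1 < p" "1 < q" and r: "0 < r" "r < 1" "\<not> algebraic r"
    and gap: "\<And>w. Z3_centered w \<Longrightarrow> 0 \<le> Z3_gap p q r w" and u: "Z3_centered u" "Z3_gap p q r u = 0"
  shows "u = (\<lambda>_. 0)"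
proof -
  define f where "f k = 1 + u k" for k
  define h where "h k = 1 + r * u k" for k
  define N where "N = (\<Sum>k\<in>UNIV. f k powr p) / 3"
  have f0: "f k \<ge> 0" for k using Z3_centered_scale[OF u(1), of 1 k] by (simp add: f_def)
  have h: "h k > 0" for k
  proof -
    have "r * (-1) \<le> r * u k" using u r by (intro mult_left_mono) (auto simp: Z3_centered_def)
    then show ?thesis using r by (simp add: h_def)
  qed
  have "\<exists>k. f k \<noteq> 0"
  proof (rule ccontr)
    assume "\<nexists>k. f k \<noteq> 0"
    then have "u k = -1" for k by (simp add: f_def add_eq_0_iff)
    then show False using u by (simp add: Z3_centered_def)
  qed
  then obtain k where "f k \<noteq> 0" by blast
  then have N: "N > 0"
    using f0 unfolding N_def by (intro divide_pos_pos sum_pos2[of _ k]) auto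
  \<comment> \<open>Every quantity in the equality, including the real powers, must lie in
    \<open>A\<close> before \<open>derivation_on_powr\<close> applies to it.\<close>
  let ?S = "{N, N powr (q / p)} \<union> range u \<union> (\<lambda>k. f k powr p) ` UNIV \<union> (\<lambda>k. h k powr q) ` UNIV"
  obtain A D where AD: "derivation_on A D" "r \<in> A" "D r = 1" "?S \<subseteq> A"
    using transcendental_derivation[OF r(3), of ?S] by auto
  note mem = derivation_on_mem[OF AD(1)] and simps = derivation_on_simps[OF AD(1)]
    and sums = derivation_on_sum[OF AD(1)]
  define v where "v k = D (u k)" for k
  have inA: "u k \<in> A" "f k powr p \<in> A" "h k powr q \<in> A" "N \<in> A" "N powr (q / p) \<in> A" for k
    using AD(4) by auto
  have fhA: "f k \<in> A" "h k \<in> A" for k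
    unfolding f_def h_def by (intro mem(1,5,6) inA AD(2))+
  have Df: "D (f k) = v k" and Dh: "D (h k) = u k + r * v k" for k
    unfolding f_def h_def v_def using inA(1)[of k] AD(2,3) by (simp_all add: simps mem)
  have v_sum: "(\<Sum>k\<in>UNIV. v k) = 0"
    using sums(2)[of UNIV u] inA u simps(1) by (simp add: v_def Z3_centered_def)
  \<comment> \<open>At a zero of \<open>f\<close>, on the boundary of the constraint,
    \<open>D 0 = 0\<close> keeps the coordinate fixed in direction \<open>v\<close>.\<close>
  have v0: "v k = 0" if "f k = 0" for k using Df[of k] that simps(1) by simp
  have Dfp: "D (f k powr p) = p * f k powr (p - 1) * v k" for k
  proof (cases "f k = 0")
    case True
    then show ?thesis using v0 simps(1) by simp
  next
    case False
    then show ?thesis using derivation_on_powr[OF AD(1) fhA(1) inA(2)] f0[of k] pq by (simp add: less_le Df)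
  qed
  have Dhq: "D (h k powr q) = q * h k powr (q - 1) * (u k + r * v k)" for k
    using derivation_on_powr[OF AD(1) fhA(2) inA(3) h] pq by (simp add: Dh)
  have DN: "D (N powr (q / p)) = q / p * N powr (q / p - 1) * D N"
    using derivation_on_powr[OF AD(1) inA(4,5) N] pq by (simp add: Rats_divide)
  \<comment> \<open>\<open>A\<close> need not contain 1/3, so the means are treated as threefold
    sums.\<close>
  have three: "D (x + x + x) = D x + D x + D x" if "x \<in> A" for x
    unfolding simps(4)[OF mem(5)[OF that that] that] simps(4)[OF that that] ..
  have "N + N + N = (\<Sum>k\<in>UNIV. f k powr p)" by (simp add: N_def)
  then have DN3: "3 * D N = (\<Sum>k\<in>UNIV. p * f k powr (p - 1) * v k)"
    using three[OF inA(4)] sums(2)[of UNIV "\<lambda>k. f k powr p"] inA by (simp add: Dfp)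
  have "N powr (q / p) + N powr (q / p) + N powr (q / p) = (\<Sum>k\<in>UNIV. h k powr q)"
    using u by (simp add: Z3_gap_def N_def f_def h_def)
  then have "3 * D (N powr (q / p)) = (\<Sum>k\<in>UNIV. q * h k powr (q - 1) * (u k + r * v k))"
    using three[OF inA(5)] sums(2)[of UNIV "\<lambda>k. h k powr q"] inA by (simp add: Dhq)
  then have algebraic_eq: "q / p * N powr (q / p - 1) * (\<Sum>k\<in>UNIV. p * f k powr (p - 1) * v k)
      = (\<Sum>k\<in>UNIV. q * h k powr (q - 1) * (u k + r * v k))"
    unfolding DN3[symmetric] DN by (simp only: ac_simps)
  \<comment> \<open>Perturbation of \<open>u\<close> in direction \<open>v = D u\<close> with
    \<open>r\<close> held fixed. Compared with \<open>algebraic_eq\<close>, its derivative at 0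
    lacks exactly the contribution of \<open>D r = 1\<close>.\<close>
  define g where "g t = Z3_gap p q r (\<lambda>k. u k + t * v k)" for t
  have g_alt: "g t = ((\<Sum>k\<in>UNIV. (f k + t * v k) powr p) / 3) powr (q / p)
      - (\<Sum>k\<in>UNIV. (h k + t * (r * v k)) powr q) / 3" for t
    by (simp add: g_def Z3_gap_def f_def h_def algebra_simps)
  have term_deriv: "((\<lambda>t. (a + t * b) powr c) has_real_derivative (c * a powr (c - 1) * b)) (at 0)"
    if "a > 0 \<or> b = 0" for a b c :: real
  proof (cases "b = 0")
    case False
    then show ?thesis using that by (auto intro!: derivative_eq_intros)
  qed auto
  have fv: "f k > 0 \<or> v k = 0" for k using f0[of k] v0[of k] by (auto simp: less_le)
  have "((\<lambda>t. (\<Sum>k\<in>UNIV. (f k + t * v k) powr p) / 3) has_real_derivative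
      (\<Sum>k\<in>UNIV. p * f k powr (p - 1) * v k) / 3) (at 0)"
    by (intro DERIV_cdivide DERIV_sum term_deriv fv)
  then have "((\<lambda>t. ((\<Sum>k\<in>UNIV. (f k + t * v k) powr p) / 3) powr (q / p)) has_real_derivative
      q / p * N powr (q / p - 1) * ((\<Sum>k\<in>UNIV. p * f k powr (p - 1) * v k) / 3)) (at 0)"
    using N by (intro DERIV_fun_powr[THEN DERIV_cong]) (auto simp: N_def)
  then have "(g has_real_derivative
      q / p * N powr (q / p - 1) * ((\<Sum>k\<in>UNIV. p * f k powr (p - 1) * v k) / 3)
      - (\<Sum>k\<in>UNIV. q * h k powr (q - 1) * (r * v k)) / 3) (at 0)"
    unfolding g_alt by (intro DERIV_diff DERIV_cdivide DERIV_sum term_deriv disjI1 h)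
  \<comment> \<open>For small \<open>t\<close> of either sign the perturbed function stays centered:
    positive coordinates of \<open>f\<close> stay nonnegative and zero ones do not move. So 0 is a
    two-sided local minimum of \<open>g\<close>.\<close>
  moreover have "\<exists>d>0. \<forall>t. \<bar>0 - t\<bar> < d \<longrightarrow> g 0 \<le> g t"
  proof -
    have "\<forall>\<^sub>F t in at 0. 0 \<le> f k + t * v k" for k
    proof (cases "v k = 0")
      case False
      then have "((\<lambda>t. f k + t * v k) \<longlongrightarrow> f k) (at 0)" "f k > 0"
        using fv[of k] by (auto intro!: tendsto_eq_intros)
      then show ?thesis by (metis (mono_tags, lifting) order_tendstoD(1) eventually_mono less_imp_le)
    qed (use f0 in simp)
    then have "\<forall>\<^sub>F t in at 0. \<forall>k. 0 \<le> f k + t * v k" by (simp add: eventually_all_finite)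
    then obtain d where d: "d > 0" "\<And>t k. t \<noteq> 0 \<Longrightarrow> \<bar>t\<bar> < d \<Longrightarrow> 0 \<le> f k + t * v k"
      by (auto simp: eventually_at dist_real_def)
    have "g 0 \<le> g t" if "\<bar>0 - t\<bar> < d" for t
    proof -
      have "0 \<le> f k + t * v k" for k using d(2)[of t k] f0[of k] that by (cases "t = 0") auto
      then have "Z3_centered (\<lambda>k. u k + t * v k)"
        using u v_sum by (auto simp: Z3_centered_def sum.distrib f_def algebra_simps simp flip: sum_distrib_left)
          (smt (verit))
      then show ?thesis using gap u by (simp add: g_def)
    qed
    then show ?thesis using d by blast
  qed
  ultimately have "q / p * N powr (q / p - 1) * ((\<Sum>k\<in>UNIV. p * f k powr (p - 1) * v k) / 3)
      - (\<Sum>k\<in>UNIV. q * h k powr (q - 1) * (r * v k)) / 3 = 0"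
    using DERIV_local_min by blast
  \<comment> \<open>Eliminating the \<open>f\<close>-sum through \<open>algebraic_eq\<close> leaves
    two \<open>h\<close>-sums that differ only in the terms \<open>u k\<close>.\<close>
  then have "(\<Sum>k\<in>UNIV. q * h k powr (q - 1) * (u k + r * v k)) = (\<Sum>k\<in>UNIV. q * h k powr (q - 1) * (r * v k))"
    using algebraic_eq by simp
  then have "q * (\<Sum>k\<in>UNIV. h k powr (q - 1) * u k) = 0"
    by (simp add: distrib_left sum.distrib sum_distrib_left mult.assoc)
  then have "(\<Sum>k\<in>UNIV. (1 + r * u k) powr (q - 1) * u k) = 0" using pq by (simp add: h_def)
  then have "u k = 0" for k
    using centered_weighted_power_sum_eq_0[of r q u k] r pq u h by (simp add: Z3_centered_def h_def)
  then show ?thesis by blast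
qed

section \<open>Limits of violations\<close>

text \<open>Values at least -1 with sum zero are bounded, and both conditions survive limits.
  Viewing the functions as vectors makes Bolzano-Weierstrass available.\<close>

lemma Z3_centered_subsequence:
  assumes "\<And>n. Z3_centered (u n)"
  obtains w \<phi> where "strict_mono (\<phi> :: nat \<Rightarrow> nat)" "Z3_centered w" "\<And>k. (\<lambda>n. u (\<phi> n) k) \<longlonglongrightarrow> w k"
proof -
  define x where "x n = (\<chi> k. u n k)" for n
  have "\<bar>u n k\<bar> \<le> 3" for n k
  proof -
    have ge: "-1 \<le> u n j" for j using assms[of n] by (simp add: Z3_centered_def)
    have "0 \<le> u n 0 + 1" "0 \<le> u n 1 + 1" "0 \<le> u n 2 + 1" "u n 0 + u n 1 + u n 2 = 0"
      using ge[of 0] ge[of 1] ge[of 2] assms[of n] 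
      unfolding Z3_centered_def sum_3 Z3_three by linarith+
    moreover have "k = 0 \<or> k = 1 \<or> k = 2" using exhaust_3[of k] by auto
    ultimately show ?thesis by auto
  qed
  then have "norm (x n) \<le> (\<Sum>k\<in>(UNIV::3 set). 3)" for n
    by (intro order_trans[OF norm_le_l1_cart] sum_mono) (simp add: x_def)
  then have "bounded (range x)" by (auto simp: bounded_iff)
  then obtain l \<phi> where \<phi>: "strict_mono \<phi>" "(x \<circ> \<phi>) \<longlonglongrightarrow> l"
    using bounded_imp_convergent_subsequence by blast
  have lim: "(\<lambda>n. u (\<phi> n) k) \<longlonglongrightarrow> l $ k" for k
    using tendsto_vec_nth[OF \<phi>(2), of k] by (simp add: x_def o_def)
  have "(\<lambda>n. \<Sum>k\<in>UNIV. u (\<phi> n) k) \<longlonglongrightarrow> (\<Sum>k\<in>UNIV. l $ k)" by (intro tendsto_sum lim)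
  then have "(\<Sum>k\<in>UNIV. l $ k) = 0"
    using assms by (simp add: Z3_centered_def LIMSEQ_const_iff)
  moreover have "-1 \<le> l $ k" for k
    using assms by (intro LIMSEQ_le_const[OF lim]) (auto simp: Z3_centered_def)
  ultimately show ?thesis using that[of \<phi> "\<lambda>k. l $ k"] \<phi> lim by (simp add: Z3_centered_def)
qed

text \<open>The limiting bases may be zero; continuity of \<open>powr\<close> there relies on
  positive exponents and nonnegative bases along the sequence.\<close>

lemma tendsto_Z3_gap:
  assumes "1 < p" "1 < q" "s \<longlonglongrightarrow> r" "\<And>k. (\<lambda>n. u n k) \<longlonglongrightarrow> w k"
    and "\<And>n k. 0 \<le> 1 + u n k" "\<And>n k. 0 \<le> 1 + s n * u n k"
  shows "(\<lambda>n. Z3_gap p q (s n) (u n)) \<longlonglongrightarrow> Z3_gap p q r w"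
  unfolding Z3_gap_def using assms
  by (intro tendsto_intros tendsto_powr') (auto intro!: always_eventually sum_nonneg divide_pos_pos)

section \<open>Second-order expansion at the constant function\<close>

definition powr_remainder :: "real \<Rightarrow> real \<Rightarrow> real" where
  "powr_remainder a w = (if w = 0 then a * (a - 1) / 2 else ((1 + w) powr a - 1 - a * w) / w\<^sup>2)"

text \<open>An exact identity, so that limits below need only continuity of the remainder factor at
  0.\<close>

lemma powr_remainder: "(1 + w) powr a = 1 + a * w + w\<^sup>2 * powr_remainder a w"
  by (simp add: powr_remainder_def)

lemma isCont_powr_remainder: "isCont (powr_remainder a) 0"
proof -
  have "((\<lambda>w::real. ((1 + w) powr a - 1 - a * w) / w\<^sup>2) \<longlongrightarrow> a * (a - 1) / 2) (at 0)"
    by real_asymp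
  then have "(powr_remainder a \<longlongrightarrow> a * (a - 1) / 2) (at 0)"
    by (rule Lim_transform_eventually) (auto simp: eventually_at_filter powr_remainder_def)
  then show ?thesis by (simp add: isCont_def powr_remainder_def)
qed

text \<open>The normalized squares are nonnegative weights with sum one, so the mean converges even
  if the direction of \<open>u n\<close> does not.\<close>

lemma tendsto_weighted_mean:
  fixes u :: "nat \<Rightarrow> 'a::finite \<Rightarrow> real"
  assumes "\<And>n. u n \<noteq> (\<lambda>_. 0)" "\<And>k. (\<lambda>n. c n k) \<longlonglongrightarrow> l"
  shows "(\<lambda>n. (\<Sum>k\<in>UNIV. (u n k)\<^sup>2 * c n k) / (\<Sum>k\<in>UNIV. (u n k)\<^sup>2)) \<longlonglongrightarrow> l"
proof -
  define V where "V n = (\<Sum>k\<in>UNIV. (u n k)\<^sup>2)" for n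
  have le: "(u n k)\<^sup>2 \<le> V n" for n k unfolding V_def by (rule member_le_sum) auto
  have V: "V n > 0" for n
  proof -
    obtain k where "u n k \<noteq> 0" using assms(1)[of n] by blast
    then show ?thesis using le[of n k] by (metis less_le_trans zero_less_power2)
  qed
  have "(\<lambda>n. (u n k)\<^sup>2 / V n * (c n k - l)) \<longlonglongrightarrow> 0" for k
  proof (rule Lim_null_comparison)
    show "\<forall>\<^sub>F n in sequentially. norm ((u n k)\<^sup>2 / V n * (c n k - l)) \<le> \<bar>c n k - l\<bar>"
    proof (intro always_eventually allI)
      fix n
      have "0 \<le> (u n k)\<^sup>2 / V n" "(u n k)\<^sup>2 / V n \<le> 1" using le[of n k] V[of n] by simp_all
      then show "norm ((u n k)\<^sup>2 / V n * (c n k - l)) \<le> \<bar>c n k - l\<bar>"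
        unfolding real_norm_def abs_mult by (intro mult_left_le_one_le) simp_all
    qed
    show "(\<lambda>n. \<bar>c n k - l\<bar>) \<longlonglongrightarrow> 0"
      using assms(2)[of k] by (simp add: LIM_zero_iff tendsto_rabs_zero_iff)
  qed
  then have "(\<lambda>n. (\<Sum>k\<in>UNIV. (u n k)\<^sup>2 / V n * (c n k - l)) + l) \<longlonglongrightarrow> (\<Sum>k\<in>(UNIV::'a set). 0) + l"
    by (intro tendsto_intros)
  moreover have "(\<Sum>k\<in>UNIV. (u n k)\<^sup>2 / V n * (c n k - l)) + l = (\<Sum>k\<in>UNIV. (u n k)\<^sup>2 * c n k) / V n" for n
  proof -
    have "(\<Sum>k\<in>UNIV. (u n k)\<^sup>2 / V n * (c n k - l))
        = (\<Sum>k\<in>UNIV. (u n k)\<^sup>2 * c n k / V n) - (\<Sum>k\<in>UNIV. (u n k)\<^sup>2) / V n * l"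
      unfolding sum_divide_distrib sum_distrib_right sum_subtractf[symmetric]
      by (intro sum.cong refl) (simp add: right_diff_distrib)
    then show ?thesis using V[of n] by (simp add: sum_divide_distrib flip: V_def)
  qed
  ultimately show ?thesis by (simp add: V_def)
qed

text \<open>The linear terms vanish because \<open>u n\<close> sums to zero, and the quadratic ones
  depend only on the sum of squares. The limit is therefore the same for every direction of
  approach.\<close>

lemma Z3_gap_second_order:
  assumes pq: "1 < p" "1 < q" and s: "s \<longlonglongrightarrow> r" and u: "\<And>k. (\<lambda>n. u n k) \<longlonglongrightarrow> 0"
    "\<And>n. u n \<noteq> (\<lambda>_. 0)" "\<And>n. Z3_centered (u n)"
  shows "(\<lambda>n. Z3_gap p q (s n) (u n) / (\<Sum>k\<in>UNIV. (u n k)\<^sup>2)) \<longlonglongrightarrow> q / 6 * (p - 1 - r\<^sup>2 * (q - 1))"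
proof -
  define V where "V n = (\<Sum>k\<in>UNIV. (u n k)\<^sup>2)" for n
  define P where "P n = (\<Sum>k\<in>UNIV. (u n k)\<^sup>2 * powr_remainder p (u n k))" for n
  define Q where "Q n = (\<Sum>k\<in>UNIV. (u n k)\<^sup>2 * powr_remainder q (s n * u n k))" for n
  have V0: "V \<longlonglongrightarrow> 0"
    unfolding V_def by (rule tendsto_eq_intros u | simp)+
  have V: "V n \<noteq> 0" for n
    using u(2)[of n] by (auto simp: V_def sum_nonneg_eq_0_iff)
  have su: "(\<lambda>n. s n * u n k) \<longlonglongrightarrow> 0" for k using tendsto_mult[OF s u(1)] by simp
  have P: "(\<lambda>n. P n / V n) \<longlonglongrightarrow> powr_remainder p 0" and Q: "(\<lambda>n. Q n / V n) \<longlonglongrightarrow> powr_remainder q 0"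
    unfolding P_def Q_def V_def
    by (intro tendsto_weighted_mean u isCont_tendsto_compose[OF isCont_powr_remainder] su)+
  have P0: "(\<lambda>n. P n / 3) \<longlonglongrightarrow> 0"
    using tendsto_mult[OF P V0] V by (auto intro!: tendsto_divide_zero)
  have sum0: "(\<Sum>k\<in>UNIV. u n k) = 0" for n using u(3) by (simp add: Z3_centered_def)
  \<comment> \<open>The outer power is expanded at \<open>1 + P n / 3\<close>; its second-order term
    keeps a spare factor \<open>P n / 3\<close>, which tends to zero.\<close>
  have "Z3_gap p q (s n) (u n) / V n
      = q / p * (P n / V n) / 3 + P n / 3 * (P n / V n / 3) * powr_remainder (q / p) (P n / 3)
        - (s n)\<^sup>2 * (Q n / V n) / 3" for n
  proof -
    have "(\<Sum>k\<in>UNIV. (1 + u n k) powr p) / 3 = 1 + P n / 3"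
      unfolding powr_remainder by (simp add: sum.distrib P_def sum0 flip: sum_distrib_left)
    moreover have "(\<Sum>k\<in>UNIV. (1 + s n * u n k) powr q) / 3 = 1 + (s n)\<^sup>2 * Q n / 3"
      unfolding powr_remainder
      by (simp add: sum.distrib Q_def sum0 power_mult_distrib mult.assoc flip: sum_distrib_left)
    ultimately have "Z3_gap p q (s n) (u n) = (1 + P n / 3) powr (q / p) - (1 + (s n)\<^sup>2 * Q n / 3)"
      unfolding Z3_gap_def by (simp only:)
    also have "\<dots> = q / p * (P n / 3) + (P n / 3)\<^sup>2 * powr_remainder (q / p) (P n / 3) - (s n)\<^sup>2 * Q n / 3"
      unfolding powr_remainder[of "P n / 3"] by simp
    finally show ?thesis using V[of n] by (simp add: add_divide_distrib diff_divide_distrib power2_eq_square)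
  qed
  moreover have "(\<lambda>n. q / p * (P n / V n) / 3 + P n / 3 * (P n / V n / 3) * powr_remainder (q / p) (P n / 3)
        - (s n)\<^sup>2 * (Q n / V n) / 3) \<longlonglongrightarrow> 
      q / p * powr_remainder p 0 / 3 + 0 * (powr_remainder p 0 / 3) * powr_remainder (q / p) 0
        - r\<^sup>2 * powr_remainder q 0 / 3"
    by (intro tendsto_intros P Q P0 s isCont_tendsto_compose[OF isCont_powr_remainder]) auto
  moreover have "q / p * powr_remainder p 0 / 3 + 0 * (powr_remainder p 0 / 3) * powr_remainder (q / p) 0
        - r\<^sup>2 * powr_remainder q 0 / 3 = q / 6 * (p - 1 - r\<^sup>2 * (q - 1))"
    using pq by (simp add: powr_remainder_def field_simps)
  ultimately show ?thesis unfolding V_def by (simp only:)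
qed

section \<open>Algebraicity of the optimal constant\<close>

theorem corollary1p5:
  fixes p q :: real
  assumes "p \<in> \<rat>" and "q \<in> \<rat>" and "1 < p" and "p < q"
  shows "algebraic (Z3_r p q)"
proof (rule ccontr)
  define r where "r = Z3_r p q"
  assume "\<not> algebraic (Z3_r p q)"
  then have nalg: "\<not> algebraic r" by (simp add: r_def)
  note att = Z3_r_attained[OF assms(3,4), folded r_def]
  \<comment> \<open>The endpoints 0 and 1 are algebraic.\<close>
  have r: "0 < r" "r < 1"
    using att(1,2) nalg by (auto simp: less_le)
  have q: "1 < q" using assms by simp
  \<comment> \<open>Parameters in \<open>(r, 1]\<close> decreasing to \<open>r\<close>; maximality
    of \<open>r\<close> makes hypercontractivity fail at each.\<close>
  define b where "b n = r + (1 - r) / real (Suc n)" for n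
  have b: "r < b n" "b n \<le> 1" for n
  proof -
    show "r < b n" using r by (simp add: b_def)
    have "(1 - r) / real (Suc n) \<le> (1 - r) / 1" using r by (intro divide_left_mono) auto
    then show "b n \<le> 1" by (simp add: b_def)
  qed
  have "\<not> Z3_hypercontractive p q (b n)" for n
    using att(4)[of "b n"] b[of n] r by fastforce
  then have "\<exists>s u. 0 \<le> s \<and> s \<le> b n \<and> Z3_centered u \<and> Z3_gap p q s u < 0" for n
    using Z3_gap_neg[of p q "b n"] b[of n] assms by (metis less_trans zero_less_one)
  then obtain s u where s0: "\<And>n. 0 \<le> s n" and sb: "\<And>n. s n \<le> b n" and u: "\<And>n. Z3_centered (u n)"
    and neg: "\<And>n. Z3_gap p q (s n) (u n) < 0"
    by metis
  have nonneg: "0 \<le> Z3_gap p q t w" if "Z3_centered w" "0 \<le> t" "t \<le> r" for t w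
  proof -
    have "Z3_hypercontractive p q t" using att(3) that by (auto simp: Z3_hypercontractive_def)
    then show ?thesis using that r assms by (intro Z3_gap_nonneg) auto
  qed
  \<comment> \<open>The violating parameter is known only to be at most \<open>b n\<close>, but no
    violation occurs up to \<open>r\<close>.\<close>
  have rs: "r < s n" for n using nonneg[OF u[of n] s0[of n]] neg[of n] by (meson not_le)
  have "b \<longlonglongrightarrow> r" unfolding b_def by real_asymp
  then have s_lim: "s \<longlonglongrightarrow> r"
    using tendsto_sandwich[of "\<lambda>_. r" s sequentially b r] less_imp_le[OF rs] sb by simp
  obtain w \<phi> where \<phi>: "strict_mono \<phi>" and w: "Z3_centered w" and lim: "\<And>k. (\<lambda>n. u (\<phi> n) k) \<longlonglongrightarrow> w k"
    using Z3_centered_subsequence[of u] u by metis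
  have s\<phi>: "(\<lambda>n. s (\<phi> n)) \<longlonglongrightarrow> r" using LIMSEQ_subseq_LIMSEQ[OF s_lim \<phi>] by (simp add: o_def)
  have s1: "s n \<le> 1" for n using sb[of n] b[of n] by simp
  have "(\<lambda>n. Z3_gap p q (s (\<phi> n)) (u (\<phi> n))) \<longlonglongrightarrow> Z3_gap p q r w"
    using Z3_centered_scale[OF u, of 1] 
    by (intro tendsto_Z3_gap assms q s\<phi> lim Z3_centered_scale[OF u s0 s1]) simp
  then have "Z3_gap p q r w \<le> 0"
    using neg by (intro LIMSEQ_le_const2) (auto intro: less_imp_le)
  then have "Z3_gap p q r w = 0" using nonneg[OF w, of r] r by simp
  then have "w = (\<lambda>_. 0)"
    using Z3_gap_zero_transcendental[of p q r w] assms q r nalg nonneg w by simp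
  then have lim0: "(\<lambda>n. u (\<phi> n) k) \<longlonglongrightarrow> 0" for k using lim[of k] by simp
  \<comment> \<open>The gap of the zero function is 0, so a violation is nonconstant and its sum of
    squares can be divided by.\<close>
  have u0: "u n \<noteq> (\<lambda>_. 0)" for n using neg[of n] by (auto simp: Z3_gap_def)
  define L where "L = q / 6 * (p - 1 - r\<^sup>2 * (q - 1))"
  \<comment> \<open>The expansion is used twice along the same functions: with the violating
    parameters it gives \<open>L \<le> 0\<close>, with the constant parameter \<open>r\<close> it
    gives \<open>L \<ge> 0\<close>.\<close>
  have "L \<le> 0"
    using less_imp_le[OF neg] unfolding L_def
    by (intro LIMSEQ_le_const2[OF Z3_gap_second_order[OF assms(3) q s\<phi> lim0 u0 u]] exI allI impI
        divide_nonpos_nonneg sum_nonneg zero_le_power2)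
  moreover have "L \<ge> 0"
    using nonneg[OF u, of r] r unfolding L_def
    by (intro LIMSEQ_le_const[OF Z3_gap_second_order[OF assms(3) q tendsto_const lim0 u0 u]] exI allI impI
        divide_nonneg_nonneg sum_nonneg zero_le_power2) auto
  ultimately have "p - 1 - r\<^sup>2 * (q - 1) = 0" using q by (simp add: L_def)
  then have "poly [:p - 1, 0, - (q - 1):] r = 0" by (simp add: power2_eq_square algebra_simps)
  moreover have "coeff [:p - 1, 0, - (q - 1):] i \<in> \<rat>" for i
    using assms by (auto simp: coeff_pCons split: nat.split)
  moreover have "[:p - 1, 0, - (q - 1):] \<noteq> 0" using assms by simp
  ultimately have "algebraic r" using algebraicI' by blast
  then show False using nalg by simp
qed

end
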